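(* Let $J:\mathbb{R}^d\times\mathbb{R}^{d'}\to\mathbb{R}$ be a differentiable function of parameters $\theta=(\theta_k,\theta_{\neq k})$, where $\theta_k\in\mathbb{R}^d$ is the parameter vector of layer $k$ and $\theta_{\neq k}\in\mathbb{R}^{d'}$ collects all other parameters. Let $\tau\mapsto\theta(\tau)$ be a differentiable parameter trajectory, and let $Z_k\in\mathbb{R}^{d\times d}$ be symmetric and positive definite. Let $b_k$ be the reflected wave at the parameter port of layer $k$, as defined in the context. Then the parameter update law that produces zero reflection is $\dot\theta_k=-Z_k^{-1}\nabla_{\theta_k}J$; that is, for every $\tau$, $$b_k(\tau)=0\quad\Longleftrightarrow\quad \dot\theta_k(\tau)=-Z_k^{-1}\,\nabla_{\theta_k}J(\theta(\tau)).$$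
   Context: Parameter port variables at layer $k$: the effort is $e_k(\tau)=-\nabla_{\theta_k}J(\theta(\tau))$ and the flow is $f_k(\tau)=\dot\theta_k(\tau)$, where the dot denotes the derivative with respect to optimization time $\tau$. The matrix $Z_k\succ0$ (symmetric positive definite) is the characteristic impedance of the parameter port, $Z_k^{1/2}$ is its symmetric positive definite square root, and $Z_k^{-1/2}=(Z_k^{1/2})^{-1}$. The incident wave $a_k$ and reflected wave $b_k$ are $$a_k=\tfrac{1}{\sqrt2}\bigl(Z_k^{-1/2}e_k+Z_k^{1/2}f_k\bigr),\qquad b_k=\tfrac{1}{\sqrt2}\bigl(Z_k^{-1/2}e_k-Z_k^{1/2}f_k\bigr).$$ Zero reflection means $b_k=0$. *)

theory Defs
  imports "HOL-Analysis.Analysis"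
begin

definition sym_pos_def :: "real^'n^'n \<Rightarrow> bool" where
  "sym_pos_def Z \<longleftrightarrow> transpose Z = Z \<and> (\<forall>x. x \<noteq> 0 \<longrightarrow> 0 < x \<bullet> (Z *v x))"

(* Only meaningful for symmetric positive definite Z, where the root exists and is unique. *)
definition mat_sqrt :: "real^'n^'n \<Rightarrow> real^'n^'n" where
  "mat_sqrt Z = (THE S. sym_pos_def S \<and> S ** S = Z)"

(* A parameter is a pair (theta_k, theta_{\<noteq>k}); the gradient is taken in the first
   component with the second one frozen. It is determined wherever the partial derivative exists. *)
definition layer_gradient ::
    "((real^'d) \<times> (real^'e) \<Rightarrow> real) \<Rightarrow> (real^'d) \<times> (real^'e) \<Rightarrow> real^'d" where
  "layer_gradient J p = (THE g. GDERIV (\<lambda>x. J (x, snd p)) (fst p) :> g)"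

definition effort ::
    "((real^'d) \<times> (real^'e) \<Rightarrow> real) \<Rightarrow> (real \<Rightarrow> (real^'d) \<times> (real^'e)) \<Rightarrow> real \<Rightarrow> real^'d" where
  "effort J \<theta> \<tau> = - layer_gradient J (\<theta> \<tau>)"

definition flow :: "(real \<Rightarrow> (real^'d) \<times> (real^'e)) \<Rightarrow> real \<Rightarrow> real^'d" where
  "flow \<theta> \<tau> = vector_derivative (\<lambda>t. fst (\<theta> t)) (at \<tau>)"

definition reflected_wave ::
    "real^'d^'d \<Rightarrow> ((real^'d) \<times> (real^'e) \<Rightarrow> real) \<Rightarrow> (real \<Rightarrow> (real^'d) \<times> (real^'e)) \<Rightarrow> real \<Rightarrow> real^'d"
  where
  "reflected_wave Z J \<theta> \<tau> =
     (1 / sqrt 2) *\<^sub>R (matrix_inv (mat_sqrt Z) *v effort J \<theta> \<tau> - mat_sqrt Z *v flow \<theta> \<tau>)"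

end

theory Submission
  imports Defs
begin

text \<open>
  The equivalence is a matter of linear algebra once the square root \<open>S = mat_sqrt Z\<close> is known to be
  a symmetric positive definite matrix with \<open>S ** S = Z\<close>: positive definite matrices are invertible,
  so \<open>matrix_inv S *v e = S *v f\<close> holds iff \<open>e = Z *v f\<close> (multiply by \<open>S\<close>), that is, iff
  \<open>f = matrix_inv Z *v e\<close>; here \<open>e\<close> is the effort (the negative gradient) and
  \<open>f\<close> the flow.

  The substance is the existence and uniqueness of the square root. Both rest on the spectral theorem
  \<open>selfadjoint_eigenbasis\<close>, obtained by maximizing the quadratic form \<open>x \<bullet> f x\<close> on unit
  spheres of invariant subspaces. For existence, take square roots of the (positive) eigenvalues. For
  uniqueness, if \<open>S\<close> and \<open>T\<close> are two such roots and \<open>D = S - T\<close>, then \<open>S D + D T = 0\<close>; pairing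
  this with an eigenvector \<open>b\<close> of \<open>D\<close> with eigenvalue \<open>\<mu>\<close> yields
  \<open>\<mu> (b \<bullet> S b + b \<bullet> T b) = 0\<close>, so every eigenvalue of \<open>D\<close> vanishes and \<open>D = 0\<close>.
\<close>

section \<open>The spectral theorem for self-adjoint maps\<close>

lemma linear_coeff_eq_0_if_quadratic_bound:
  fixes a c :: real
  assumes "\<And>t. a * t \<le> c * t\<^sup>2"
  shows "a = 0"
proof (rule ccontr)
  assume "a \<noteq> 0"
  define k where "k = \<bar>c\<bar> + 1"
  have k: "k > 0" "c < k" by (auto simp: k_def)
  \<comment> \<open>At \<open>t = a / k\<close> the bound reads \<open>a\<^sup>2 / k \<le> (c / k) (a\<^sup>2 / k)\<close>, and \<open>c / k < 1\<close>.\<close>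
  have "a * (a / k) \<le> c * (a / k)\<^sup>2" by (rule assms)
  then have "k * a\<^sup>2 \<le> c * a\<^sup>2"
    using k by (simp add: field_simps power2_eq_square)
  then show False using k \<open>a \<noteq> 0\<close> by simp
qed

text \<open>A maximizer of the quadratic form on the unit sphere of an invariant subspace is an
  eigenvector: the first variation of the form vanishes in all directions of the subspace
  orthogonal to the maximizer, and \<open>f v - \<mu> v\<close> is such a direction.\<close>

lemma selfadjoint_eigenvector:
  fixes f :: "'a::euclidean_space \<Rightarrow> 'a"
  assumes f: "linear f" and adj: "\<And>x y. f x \<bullet> y = x \<bullet> f y"
    and V: "subspace V" "\<And>x. x \<in> V \<Longrightarrow> f x \<in> V" "V \<noteq> {0}"
  obtains v \<mu> where "v \<in> V" "norm v = 1" "f v = \<mu> *\<^sub>R v"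
proof -
  let ?K = "sphere 0 1 \<inter> V"
  obtain u where u: "u \<in> V" "u \<noteq> 0"
    using V(3) subspace_0[OF V(1)] by auto
  have "(1 / norm u) *\<^sub>R u \<in> ?K"
    using u V(1) by (simp add: subspace_scale)
  then have "?K \<noteq> {}" by blast
  moreover have "compact ?K"
    by (simp add: V(1) closed_subspace compact_Int_closed)
  moreover have "continuous_on ?K (\<lambda>x. x \<bullet> f x)"
    by (intro continuous_intros linear_continuous_on_compose[OF _ f])
  ultimately obtain v where v: "v \<in> V" "norm v = 1"
    and max: "\<And>x. x \<in> ?K \<Longrightarrow> x \<bullet> f x \<le> v \<bullet> f v"
    using continuous_attains_sup[of ?K "\<lambda>x. x \<bullet> f x"] by (metis IntE mem_sphere_0)
  have vv: "v \<bullet> v = 1" using v(2) by (simp add: norm_eq_1)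
  define \<mu> where "\<mu> = v \<bullet> f v"
  have bound: "x \<bullet> f x \<le> \<mu> * (x \<bullet> x)" if "x \<in> V" for x
  proof (cases "x = 0")
    case True
    then show ?thesis by simp
  next
    case False
    then have "(1 / norm x) *\<^sub>R x \<in> ?K"
      using that V(1) by (simp add: subspace_scale)
    from max[OF this] show ?thesis
      using False by (simp add: linear_scale[OF f] \<mu>_def field_simps dot_square_norm power2_eq_square)
  qed
  define w where "w = f v - \<mu> *\<^sub>R v"
  have wV: "w \<in> V"
    unfolding w_def by (simp add: V v subspace_diff subspace_scale)
  have vw: "v \<bullet> w = 0"
    by (simp add: w_def \<mu>_def inner_diff_right vv)
  have "2 * (w \<bullet> f v) * t \<le> (\<mu> * (w \<bullet> w) - w \<bullet> f w) * t\<^sup>2" for t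
  proof -
    have "v + t *\<^sub>R w \<in> V"
      by (simp add: V(1) subspace_add subspace_scale v(1) wV)
    moreover have "v \<bullet> f w = w \<bullet> f v"
      by (metis adj inner_commute)
    moreover have "w \<bullet> v = 0" by (metis vw inner_commute)
    ultimately show ?thesis
      using bound[of "v + t *\<^sub>R w"] vv vw
      by (simp add: linear_add[OF f] linear_scale[OF f] inner_add \<mu>_def[symmetric]
          algebra_simps power2_eq_square)
  qed
  then have "2 * (w \<bullet> f v) = 0"
    by (rule linear_coeff_eq_0_if_quadratic_bound)
  then have "w \<bullet> w = 0"
    using vw by (simp add: w_def inner_diff_right inner_commute)
  then have "f v = \<mu> *\<^sub>R v"
    by (simp add: w_def)
  with v that show thesis by blast
qed

lemma selfadjoint_eigenbasis_subspace:
  fixes f :: "'a::euclidean_space \<Rightarrow> 'a"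
  assumes f: "linear f" and adj: "\<And>x y. f x \<bullet> y = x \<bullet> f y"
    and "subspace V" "\<And>x. x \<in> V \<Longrightarrow> f x \<in> V"
  shows "\<exists>B. B \<subseteq> V \<and> pairwise orthogonal B \<and> V \<subseteq> span B \<and>
           (\<forall>b\<in>B. norm b = 1 \<and> (\<exists>\<mu>. f b = \<mu> *\<^sub>R b))"
  using assms(3,4)
proof (induction "dim V" arbitrary: V rule: less_induct)
  case less
  show ?case
  proof (cases "V = {0}")
    case True
    then show ?thesis by (intro exI[of _ "{}"]) auto
  next
    case False
    then obtain v \<mu> where v: "v \<in> V" "norm v = 1" "f v = \<mu> *\<^sub>R v"
      using selfadjoint_eigenvector[OF f adj less.prems] by metis
    have vv: "v \<bullet> v = 1" using v(2) by (simp add: norm_eq_1)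
    define W where "W = {x \<in> V. v \<bullet> x = 0}"
    have W: "subspace W"
      using less.prems(1) unfolding W_def subspace_def by (auto simp: inner_add_right)
    have fW: "f x \<in> W" if "x \<in> W" for x
      using that less.prems(2) adj[of v x] v(3) by (simp add: W_def)
    have "v \<notin> W"
      using vv by (simp add: W_def)
    moreover have "W \<subseteq> V"
      by (auto simp: W_def)
    ultimately have "W \<subset> V"
      using v(1) by blast
    then have "dim W < dim V"
      using W less.prems(1) by (metis dim_psubset span_eq_iff)
    from less.hyps[OF this W fW] obtain B where
      B: "B \<subseteq> W" "pairwise orthogonal B" "W \<subseteq> span B"
         "\<And>b. b \<in> B \<Longrightarrow> norm b = 1 \<and> (\<exists>\<mu>. f b = \<mu> *\<^sub>R b)"
      by blast
    have "V \<subseteq> span (insert v B)"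
    proof
      fix x assume "x \<in> V"
      then have "x - (v \<bullet> x) *\<^sub>R v \<in> W"
        using v(1) less.prems(1) vv
        by (simp add: W_def subspace_diff subspace_scale inner_diff_right)
      then show "x \<in> span (insert v B)"
        using B(3) span_breakdown_eq by blast
    qed
    moreover have "pairwise orthogonal (insert v B)"
      using B(1,2) by (auto simp: pairwise_insert W_def orthogonal_def inner_commute)
    moreover have "insert v B \<subseteq> V"
      using v(1) B(1) by (auto simp: W_def)
    ultimately show ?thesis
      using v(2,3) B(4) by (intro exI[of _ "insert v B"]) blast
  qed
qed

theorem selfadjoint_eigenbasis:
  fixes f :: "'a::euclidean_space \<Rightarrow> 'a"
  assumes "linear f" "\<And>x y. f x \<bullet> y = x \<bullet> f y"
  obtains B \<mu> where "finite B" "pairwise orthogonal B" "span B = UNIV"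
    "\<And>b. b \<in> B \<Longrightarrow> norm b = 1" "\<And>b. b \<in> B \<Longrightarrow> f b = \<mu> b *\<^sub>R b"
proof -
  obtain B where B: "pairwise orthogonal B" "UNIV \<subseteq> span B"
    "\<And>b. b \<in> B \<Longrightarrow> norm b = 1" "\<And>b. b \<in> B \<Longrightarrow> \<exists>\<mu>. f b = \<mu> *\<^sub>R b"
    using selfadjoint_eigenbasis_subspace[OF assms, of UNIV] by auto
  then obtain \<mu> where "\<And>b. b \<in> B \<Longrightarrow> f b = \<mu> b *\<^sub>R b"
    by metis
  moreover have "finite B"
    using B(1) by (rule pairwise_orthogonal_imp_finite)
  moreover have "span B = UNIV"
    using B(2) by blast
  ultimately show thesis using that B(1,3) by blast
qed

section \<open>Symmetric positive definite matrices and their square roots\<close>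

lemma inner_matrix_vector_transpose:
  fixes A :: "real^'n^'m"
  shows "(A *v x) \<bullet> y = x \<bullet> (transpose A *v y)"
  by (metis dot_lmul_matrix inner_commute transpose_matrix_vector)

lemma symmetric_matrix_iff:
  fixes A :: "real^'n^'n"
  shows "transpose A = A \<longleftrightarrow> (\<forall>x y. (A *v x) \<bullet> y = x \<bullet> (A *v y))"
  by (metis inner_matrix_vector_transpose matrix_eq vector_eq_ldot)

lemma sym_pos_def_inner_commute:
  "sym_pos_def A \<Longrightarrow> (A *v x) \<bullet> y = x \<bullet> (A *v y)"
  by (simp add: sym_pos_def_def symmetric_matrix_iff)

lemma sym_pos_def_imp_invertible:
  fixes A :: "real^'n^'n"
  assumes "sym_pos_def A"
  shows "invertible A"
proof -
  have "x = 0" if "A *v x = 0" for x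
    using assms that unfolding sym_pos_def_def by (metis inner_zero_right less_irrefl)
  then show ?thesis
    by (metis invertible_left_inverse matrix_left_invertible_ker)
qed

lemma sym_pos_def_sqrt_exists:
  fixes Z :: "real^'n^'n"
  assumes Z: "sym_pos_def Z"
  shows "\<exists>S. sym_pos_def S \<and> S ** S = Z"
proof -
  obtain B \<mu> where B: "finite B" "pairwise orthogonal B" "span B = UNIV"
    "\<And>b. b \<in> B \<Longrightarrow> norm b = 1" and eig: "\<And>b. b \<in> B \<Longrightarrow> Z *v b = \<mu> b *\<^sub>R b"
    using selfadjoint_eigenbasis[OF matrix_vector_mul_linear sym_pos_def_inner_commute[OF Z]]
    by metis
  have orth: "b \<bullet> c = (if b = c then 1 else 0)" if "b \<in> B" "c \<in> B" for b c
    using that B(2,4) by (auto simp: pairwise_def orthogonal_def norm_eq_1)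
  have pos: "\<mu> b > 0" if "b \<in> B" for b
  proof -
    have "b \<noteq> 0" using B(4)[OF that] by auto
    then have "0 < b \<bullet> (Z *v b)" using Z by (simp add: sym_pos_def_def)
    then show ?thesis using eig[OF that] orth[OF that that] by simp
  qed
  define g where "g x = (\<Sum>b\<in>B. (sqrt (\<mu> b) * (b \<bullet> x)) *\<^sub>R b)" for x
  have lin: "linear g"
    by (rule linearI)
      (simp_all add: g_def inner_add_right algebra_simps sum.distrib scaleR_sum_right)
  have Sg: "matrix g *v x = g x" for x
    using lin by (simp add: matrix_works)
  have gb: "g c = sqrt (\<mu> c) *\<^sub>R c" if "c \<in> B" for c
  proof -
    have "g c = (\<Sum>b\<in>B. if b = c then sqrt (\<mu> c) *\<^sub>R c else 0)"
      unfolding g_def using that by (intro sum.cong) (auto simp: orth)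
    then show ?thesis using B(1) that by simp
  qed
  have inner_g: "g x \<bullet> y = (\<Sum>b\<in>B. sqrt (\<mu> b) * (b \<bullet> x) * (b \<bullet> y))" for x y
    by (simp add: g_def inner_sum_left)
  have "g x \<bullet> y = x \<bullet> g y" for x y
    unfolding inner_commute[of x] inner_g by (simp add: mult_ac)
  then have "transpose (matrix g) = matrix g"
    by (simp add: symmetric_matrix_iff Sg)
  moreover have "0 < x \<bullet> g x" if "x \<noteq> 0" for x
  proof -
    obtain c where c: "c \<in> B" "c \<bullet> x \<noteq> 0"
    proof (rule ccontr)
      assume "\<not> thesis"
      then have "\<And>b. b \<in> B \<Longrightarrow> orthogonal x b"
        using that by (auto simp: orthogonal_def inner_commute)
      then have "orthogonal x x"
        using B(3) orthogonal_to_span[of x B x] by auto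
      then show False using \<open>x \<noteq> 0\<close> by (simp add: orthogonal_def)
    qed
    have "x \<bullet> g x = (\<Sum>b\<in>B. sqrt (\<mu> b) * (b \<bullet> x)\<^sup>2)"
      unfolding inner_commute[of x] inner_g by (simp add: power2_eq_square mult_ac)
    also have "\<dots> > 0"
      using B(1) c pos by (intro sum_pos2[of _ c]) (auto simp: less_imp_le)
    finally show ?thesis .
  qed
  ultimately have "sym_pos_def (matrix g)"
    by (simp add: sym_pos_def_def Sg)
  moreover have "matrix g ** matrix g = Z"
  proof -
    have "g (g x) = Z *v x" for x
    proof (rule linear_eq_on_span[of "\<lambda>x. g (g x)" "(*v) Z" B])
      show "linear (\<lambda>x. g (g x))"
        using linear_compose[OF lin lin] by (simp add: o_def)
      show "g (g b) = Z *v b" if "b \<in> B" for b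
        using that pos[OF that] by (simp add: gb linear_scale[OF lin] eig)
    qed (simp_all add: B(3))
    then show ?thesis
      by (simp add: matrix_eq Sg flip: matrix_vector_mul_assoc)
  qed
  ultimately show ?thesis by blast
qed

lemma sym_pos_def_sqrt_unique:
  fixes S T :: "real^'n^'n"
  assumes S: "sym_pos_def S" and T: "sym_pos_def T" and eq: "S ** S = T ** T"
  shows "S = T"
proof -
  let ?D = "S - T"
  have adj: "(?D *v x) \<bullet> y = x \<bullet> (?D *v y)" for x y
    by (simp add: matrix_vector_mult_diff_rdistrib inner_diff
        sym_pos_def_inner_commute[OF S] sym_pos_def_inner_commute[OF T])
  obtain B \<mu> where B: "span B = UNIV"
    "\<And>b. b \<in> B \<Longrightarrow> norm b = 1" "\<And>b. b \<in> B \<Longrightarrow> ?D *v b = \<mu> b *\<^sub>R b"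
    using selfadjoint_eigenbasis[OF matrix_vector_mul_linear adj] by metis
  have "?D *v b = 0" if "b \<in> B" for b
  proof -
    have SS: "S *v (S *v b) = T *v (T *v b)"
      by (simp add: matrix_vector_mul_assoc eq)
    have "b \<noteq> 0" using B(2)[OF that] by auto
    then have "0 < b \<bullet> (S *v b) + b \<bullet> (T *v b)"
      using S T by (simp add: sym_pos_def_def add_pos_pos)
    moreover have "\<mu> b * (b \<bullet> (S *v b) + b \<bullet> (T *v b)) = 0"
    proof -
      \<comment> \<open>The left-hand side is the pairing of \<open>b\<close> with \<open>S D b + D T b\<close>, where \<open>D = S - T\<close>.\<close>
      have "\<mu> b * (b \<bullet> (S *v b)) + \<mu> b * (b \<bullet> (T *v b))
          = b \<bullet> (S *v (?D *v b)) + (?D *v b) \<bullet> (T *v b)"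
        using B(3)[OF that] by (simp add: matrix_vector_mult_scaleR)
      also have "\<dots> = b \<bullet> (S *v (?D *v b)) + b \<bullet> (?D *v (T *v b))"
        by (simp only: adj)
      also have "\<dots> = 0"
        by (simp add: matrix_vector_mult_diff_rdistrib matrix_vector_mult_diff_distrib
            inner_diff_right SS)
      finally show ?thesis by (simp add: distrib_left)
    qed
    ultimately show ?thesis using B(3)[OF that] by auto
  qed
  then have "?D *v x = 0" for x
    using linear_eq_0_on_span[OF matrix_vector_mul_linear, of B ?D x] B(1) by auto
  then show ?thesis
    by (simp add: matrix_eq matrix_vector_mult_diff_rdistrib)
qed

lemma mat_sqrt:
  fixes Z :: "real^'n^'n"
  assumes "sym_pos_def Z"
  shows "sym_pos_def (mat_sqrt Z)" "mat_sqrt Z ** mat_sqrt Z = Z"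
proof -
  have "\<exists>!S. sym_pos_def S \<and> S ** S = Z"
    using sym_pos_def_sqrt_exists[OF assms] sym_pos_def_sqrt_unique by metis
  from theI'[OF this]
  show "sym_pos_def (mat_sqrt Z)" "mat_sqrt Z ** mat_sqrt Z = Z"
    unfolding mat_sqrt_def by blast+
qed

section \<open>Zero reflection\<close>

lemma matrix_inv_vector_eq_iff:
  fixes A :: "real^'n^'n"
  assumes "invertible A"
  shows "matrix_inv A *v x = y \<longleftrightarrow> x = A *v y"
proof -
  have "A ** matrix_inv A = mat 1" "matrix_inv A ** A = mat 1"
    using someI_ex[OF assms[unfolded invertible_def]] by (simp_all add: matrix_inv_def)
  then show ?thesis
    by (metis matrix_vector_mul_assoc matrix_vector_mul_lid)
qed

theorem theorem4p4:
  fixes J :: "(real^'d) \<times> (real^'e) \<Rightarrow> real"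
    and \<theta> :: "real \<Rightarrow> (real^'d) \<times> (real^'e)"
    and Z :: "real^'d^'d"
  assumes "\<And>p. J differentiable (at p)"
    and "\<And>\<tau>. \<theta> differentiable (at \<tau>)"
    and "sym_pos_def Z"
  shows "\<forall>\<tau>. reflected_wave Z J \<theta> \<tau> = 0 \<longleftrightarrow>
           vector_derivative (\<lambda>t. fst (\<theta> t)) (at \<tau>) = - (matrix_inv Z *v layer_gradient J (\<theta> \<tau>))"
proof
  fix \<tau>
  let ?S = "mat_sqrt Z" and ?e = "effort J \<theta> \<tau>" and ?f = "flow \<theta> \<tau>"
  have S: "invertible ?S" "?S ** ?S = Z"
    using mat_sqrt[OF assms(3)] by (auto intro: sym_pos_def_imp_invertible)
  have "reflected_wave Z J \<theta> \<tau> = 0 \<longleftrightarrow> matrix_inv ?S *v ?e = ?S *v ?f"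
    by (simp add: reflected_wave_def)
  also have "\<dots> \<longleftrightarrow> ?e = Z *v ?f"
    by (simp add: matrix_inv_vector_eq_iff[OF S(1)] matrix_vector_mul_assoc S(2))
  also have "\<dots> \<longleftrightarrow> ?f = matrix_inv Z *v ?e"
    using matrix_inv_vector_eq_iff[OF sym_pos_def_imp_invertible[OF assms(3)]] by metis
  also have "matrix_inv Z *v ?e = - (matrix_inv Z *v layer_gradient J (\<theta> \<tau>))"
    by (simp add: effort_def linear_neg[OF matrix_vector_mul_linear])
  finally show "reflected_wave Z J \<theta> \<tau> = 0 \<longleftrightarrow>
      vector_derivative (\<lambda>t. fst (\<theta> t)) (at \<tau>) = - (matrix_inv Z *v layer_gradient J (\<theta> \<tau>))"
    by (simp add: flow_def)
qed

end
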